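(* Let $\mathcal{X}\subset\mathbb{R}^n$ be a convex set, $N\ge1$, and for each $k\ge1$ let $h_k=f_k+g_k$ where $f_k=\frac1N\sum_{i=1}^N f_k^i$ with each $f_k^i:\mathcal{X}\to\mathbb{R}$ differentiable, and $g_k:\mathcal{X}\to\mathbb{R}$ convex. Let $L,\mu,M>0$ be such that for all $i,k$ and all $\mathbf{x},\mathbf{y}\in\mathcal{X}$: $\|\nabla f_k^i(\mathbf{x})-\nabla f_k^i(\mathbf{y})\|\le L\|\mathbf{x}-\mathbf{y}\|$; $\langle\nabla f_k^i(\mathbf{x})-\nabla f_k^i(\mathbf{y}),\mathbf{x}-\mathbf{y}\rangle\ge\mu\|\mathbf{x}-\mathbf{y}\|^2$; and $\max_{i,k}\|\nabla f_k^i(\mathbf{x}_k)\|\le M$ along the iterates $\mathbf{x}_k$ of the online proximal gradient algorithm with increasing sample size. If the sample sizes are chosen as $|\mathcal{I}_k|=\lceil N(1-e^{-k})\rceil$ for all $k\ge1$, then the gradient errors $\mathbf{e}_k$ of this algorithm satisfy $$E_K:=\sum_{k=1}^K\mathbb{E}\|\mathbf{e}_k\|\le\mathcal{O}(1),$$ i.e. there is a constant $C$ independent of $K$ with $E_K\le C$ for all $K\ge1$.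
   Context: $\|\cdot\|$ is the Euclidean norm. Online proximal gradient algorithm with increasing sample size: initialize $\mathbf{x}_1\in\mathcal{X}$; at each time $k=1,2,\dots$ select randomly a subset $\mathcal{I}_k\subset\{1,\dots,N\}$ of the prescribed cardinality, compute $\tilde\nabla f_k(\mathbf{x}_k)=\frac{1}{|\mathcal{I}_k|}\sum_{i\in\mathcal{I}_k}\nabla f_k^i(\mathbf{x}_k)$, and update, with step size $\alpha>0$, $\mathbf{x}_{k+1}=\mathrm{prox}_{g_k}^\alpha\big(\mathbf{x}_k-\alpha\tilde\nabla f_k(\mathbf{x}_k)\big)$, where $\mathrm{prox}_{g_k}^{\alpha}(\mathbf{x})=\arg\min_{\mathbf{u}\in\mathcal{X}} g_k(\mathbf{u})+\frac{1}{2\alpha}\|\mathbf{u}-\mathbf{x}\|^2$ (the minimizer is assumed to exist). The gradient error is $$\mathbf{e}_k=\frac{1}{|\mathcal{I}_k|}\sum_{i\in\mathcal{I}_k}\nabla f_k^i(\mathbf{x}_k)-\frac1N\sum_{i=1}^N\nabla f_k^i(\mathbf{x}_k).$$ Expectation is over the random selection of the sets $\mathcal{I}_k$. *)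

theory Defs
  imports "HOL-Probability.Probability"
begin

definition prox_objective :: "real \<Rightarrow> ('a::real_normed_vector \<Rightarrow> real) \<Rightarrow> 'a \<Rightarrow> 'a \<Rightarrow> real" where
  "prox_objective \<alpha> g x u = g u + 1 / (2 * \<alpha>) * (norm (u - x))\<^sup>2"

text \<open>Meaningful only where a minimizer over \<open>X\<close> exists; for convex \<open>g\<close> and \<open>X\<close> it is then unique,
  by strict convexity of the objective.\<close>

definition prox :: "'a::real_normed_vector set \<Rightarrow> real \<Rightarrow> ('a \<Rightarrow> real) \<Rightarrow> 'a \<Rightarrow> 'a" where
  "prox X \<alpha> g x = arg_min_on (prox_objective \<alpha> g x) X"

definition sample_grad :: "(nat \<Rightarrow> 'a::real_vector \<Rightarrow> 'a) \<Rightarrow> nat set \<Rightarrow> 'a \<Rightarrow> 'a" where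
  "sample_grad G S x = (1 / real (card S)) *\<^sub>R (\<Sum>i\<in>S. G i x)"

definition grad_error :: "(nat \<Rightarrow> 'a::real_vector \<Rightarrow> 'a) \<Rightarrow> nat \<Rightarrow> nat set \<Rightarrow> 'a \<Rightarrow> 'a" where
  "grad_error G N S x = sample_grad G S x - (1 / real N) *\<^sub>R (\<Sum>i=1..N. G i x)"

end

theory Submission
  imports Defs
begin

text \<open>Splitting \<open>{1..N}\<close> into the sample \<open>S\<close> and its complement writes the gradient error as
  \<open>(1/|S| - 1/N) \<Sum>\<^bsub>S\<^esub> G\<^sub>i - 1/N \<Sum>\<^bsub>{1..N} - S\<^esub> G\<^sub>i\<close>, whose two parts each have norm at most
  \<open>(1 - |S|/N) M\<close>. The sample sizes make this at most \<open>M e\<^sup>-\<^sup>k\<close> for every outcome, and the geometric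
  series converges.\<close>

lemma norm_grad_error_le:
  fixes x :: "'a::real_normed_vector"
  assumes S: "S \<subseteq> {1..N}"
    and bound: "\<And>i. i \<in> {1..N} \<Longrightarrow> norm (G i x) \<le> M"
    and M: "M \<ge> 0"
  shows "norm (grad_error G N S x) \<le> 2 * M * (1 - real (card S) / real N)"
proof (cases "S = {}")
  \<comment> \<open>For an empty sample, division by zero makes the sampled gradient 0, so the error
    is minus the full average, of norm at most \<open>M\<close>. The right-hand side is then
    \<open>2 * M\<close>. This case also absorbs \<open>N = 0\<close>.\<close>
  case True
  have "norm (\<Sum>i=1..N. G i x) \<le> real N * M"
    using sum_norm_bound[of "{1..N}" "\<lambda>i. G i x" M] bound by simp
  then have "norm (\<Sum>i=1..N. G i x) / real N \<le> M"
    using M by (cases "N = 0") (simp_all add: field_simps)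
  with True M show ?thesis
    by (simp add: grad_error_def sample_grad_def)
next
  case False
  define n where "n = card S"
  have fin: "finite S"
    using S finite_subset by blast
  have n: "0 < n" "n \<le> N"
    using False fin S card_mono[of "{1..N}" S] by (auto simp: n_def card_gt_0_iff)
  have split: "(\<Sum>i=1..N. G i x) = (\<Sum>i\<in>S. G i x) + (\<Sum>i\<in>{1..N} - S. G i x)"
    using sum.subset_diff[OF S, of "\<lambda>i. G i x"] by (simp add: add.commute)
  have error: "grad_error G N S x =
      (1 / real n - 1 / real N) *\<^sub>R (\<Sum>i\<in>S. G i x) - (1 / real N) *\<^sub>R (\<Sum>i\<in>{1..N} - S. G i x)"
    unfolding grad_error_def sample_grad_def split n_def
    by (simp add: algebra_simps)
  have inside: "norm (\<Sum>i\<in>S. G i x) \<le> real n * M"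
    unfolding n_def using S bound by (intro sum_norm_bound) auto
  have "norm (\<Sum>i\<in>{1..N} - S. G i x) \<le> real (card ({1..N} - S)) * M"
    using bound by (intro sum_norm_bound) auto
  then have outside: "norm (\<Sum>i\<in>{1..N} - S. G i x) \<le> (real N - real n) * M"
    using n S fin by (simp add: card_Diff_subset n_def of_nat_diff)
  \<comment> \<open>Nonnegativity comes from \<open>n \<le> N\<close>; it lets the coefficient leave
    the norm unchanged and multiply the bound \<open>inside\<close>.\<close>
  have coeff: "1 / real n - 1 / real N \<ge> 0"
    using n by (simp add: field_simps)
  have "norm (grad_error G N S x) \<le>
      (1 / real n - 1 / real N) * norm (\<Sum>i\<in>S. G i x) + 1 / real N * norm (\<Sum>i\<in>{1..N} - S. G i x)"
    unfolding error using coeff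
    by (intro order_trans[OF norm_triangle_ineq4]) simp
  also have "\<dots> \<le> (1 / real n - 1 / real N) * (real n * M) + 1 / real N * ((real N - real n) * M)"
    using coeff inside outside by (intro add_mono mult_left_mono) auto
  \<comment> \<open>Each summand equals \<open>M * (1 - real n / real N)\<close>: the excess weight
    on sampled indices matches the weight missing from the others. Hence the factor 2.\<close>
  also have "\<dots> = 2 * M * (1 - real n / real N)"
    using n by (simp add: field_simps)
  finally show ?thesis
    by (simp add: n_def)
qed

theorem lemma6:
  fixes X :: "(real ^ 'n) set"
    and N :: nat
    and f :: "nat \<Rightarrow> nat \<Rightarrow> real ^ 'n \<Rightarrow> real"
    and G :: "nat \<Rightarrow> nat \<Rightarrow> real ^ 'n \<Rightarrow> real ^ 'n"
    and g :: "nat \<Rightarrow> real ^ 'n \<Rightarrow> real"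
    and L \<mu> M \<alpha> :: real
    and P :: "'w measure"
    and I :: "nat \<Rightarrow> 'w \<Rightarrow> nat set"
    and x1 :: "real ^ 'n"
    and x :: "nat \<Rightarrow> 'w \<Rightarrow> real ^ 'n"
  assumes "convex X" and "N \<ge> 1"
    and "L > 0" and "\<mu> > 0" and "M > 0" and "\<alpha> > 0"
    and gradient: "\<And>k i u. k \<ge> 1 \<Longrightarrow> i \<in> {1..N} \<Longrightarrow> u \<in> X \<Longrightarrow>
          (f k i has_derivative (\<lambda>v. G k i u \<bullet> v)) (at u within X)"
    and convex_g: "\<And>k. k \<ge> 1 \<Longrightarrow> convex_on X (g k)"
    and lipschitz: "\<And>k i u v. k \<ge> 1 \<Longrightarrow> i \<in> {1..N} \<Longrightarrow> u \<in> X \<Longrightarrow> v \<in> X \<Longrightarrow>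
          norm (G k i u - G k i v) \<le> L * norm (u - v)"
    and strongly_monotone: "\<And>k i u v. k \<ge> 1 \<Longrightarrow> i \<in> {1..N} \<Longrightarrow> u \<in> X \<Longrightarrow> v \<in> X \<Longrightarrow>
          (G k i u - G k i v) \<bullet> (u - v) \<ge> \<mu> * (norm (u - v))\<^sup>2"
    and prox_exists: "\<And>k u. k \<ge> 1 \<Longrightarrow> \<exists>v. is_arg_min (prox_objective \<alpha> (g k) u) (\<lambda>v. v \<in> X) v"
    and "prob_space P"
    and sample: "\<And>k. k \<ge> 1 \<Longrightarrow> I k \<in> measurable P (count_space (Pow {1..N}))"
    and sample_size: "\<And>k \<omega>. k \<ge> 1 \<Longrightarrow> \<omega> \<in> space P \<Longrightarrow>
          int (card (I k \<omega>)) = \<lceil>real N * (1 - exp (- real k))\<rceil>"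
    and "x1 \<in> X"
    and init: "\<And>\<omega>. \<omega> \<in> space P \<Longrightarrow> x 1 \<omega> = x1"
    and step: "\<And>k \<omega>. k \<ge> 1 \<Longrightarrow> \<omega> \<in> space P \<Longrightarrow>
          x (k + 1) \<omega> = prox X \<alpha> (g k) (x k \<omega> - \<alpha> *\<^sub>R sample_grad (G k) (I k \<omega>) (x k \<omega>))"
    and bounded_gradients: "\<And>k i \<omega>. k \<ge> 1 \<Longrightarrow> i \<in> {1..N} \<Longrightarrow> \<omega> \<in> space P \<Longrightarrow>
          norm (G k i (x k \<omega>)) \<le> M"
  shows "\<exists>C. \<forall>K\<ge>1. (\<Sum>k=1..K. \<integral>\<omega>. norm (grad_error (G k) N (I k \<omega>) (x k \<omega>)) \<partial>P) \<le> C"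
proof -
  interpret prob_space P by fact
  have bound: "(\<integral>\<omega>. norm (grad_error (G k) N (I k \<omega>) (x k \<omega>)) \<partial>P) \<le> 2 * M * exp (-1) ^ k"
    (is "integral\<^sup>L P ?e \<le> ?b") if k: "k \<ge> 1" for k
  \<comment> \<open>The case split replaces a measurability argument for the iterates: without
    integrability the integral has the default value 0, which lies below the nonnegative
    bound.\<close>
  proof (cases "integrable P ?e")
    case True
    have "?e \<omega> \<le> ?b" if \<omega>: "\<omega> \<in> space P" for \<omega>
    proof -
      have "I k \<omega> \<subseteq> {1..N}"
        using measurable_space[OF sample[OF k] \<omega>] by simp
      then have "?e \<omega> \<le> 2 * M * (1 - real (card (I k \<omega>)) / real N)"
        using bounded_gradients[OF k _ \<omega>] \<open>M > 0\<close> by (intro norm_grad_error_le) auto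
      \<comment> \<open>Rounding up can only enlarge the sample, so the unsampled fraction is at
        most \<open>exp (- real k)\<close>.\<close>
      moreover have "real (card (I k \<omega>)) \<ge> real N * (1 - exp (- real k))"
        using sample_size[OF k \<omega>] le_of_int_ceiling[of "real N * (1 - exp (- real k))"]
        by (metis of_int_of_nat_eq)
      then have "1 - real (card (I k \<omega>)) / real N \<le> exp (- real k)"
        using \<open>N \<ge> 1\<close> by (simp add: field_simps)
      then have "2 * M * (1 - real (card (I k \<omega>)) / real N) \<le> ?b"
        using \<open>M > 0\<close> exp_of_nat_mult[of k "-1 :: real"] by simp
      ultimately show ?thesis
        by linarith
    qed
    \<comment> \<open>The bound holds at every outcome and the total mass is 1, so it passes to the
      expectation.\<close>
    with True show ?thesis
      by (intro integral_le_const) (auto intro: AE_I2)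
  next
    case False
    then show ?thesis
      using \<open>M > 0\<close> by (simp add: not_integrable_integral_eq)
  qed
  have summable: "summable (\<lambda>k. exp (-1 :: real) ^ k)"
    by (intro summable_geometric) simp
  have "(\<Sum>k=1..K. \<integral>\<omega>. norm (grad_error (G k) N (I k \<omega>) (x k \<omega>)) \<partial>P)
      \<le> 2 * M * (\<Sum>k. exp (-1) ^ k)" for K
  proof -
    have "(\<Sum>k=1..K. \<integral>\<omega>. norm (grad_error (G k) N (I k \<omega>) (x k \<omega>)) \<partial>P)
        \<le> (\<Sum>k=1..K. 2 * M * exp (-1) ^ k)"
      using bound by (intro sum_mono) auto
    also have "\<dots> = 2 * M * (\<Sum>k=1..K. exp (-1) ^ k)"
      by (simp add: sum_distrib_left)
    \<comment> \<open>The terms are nonnegative, so the full series, which also includes the index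
      0, dominates every partial sum. This yields a constant \<open>C\<close> independent of
      \<open>K\<close>.\<close>
    also have "\<dots> \<le> 2 * M * (\<Sum>k. exp (-1) ^ k)"
      using \<open>M > 0\<close> by (intro mult_left_mono sum_le_suminf[OF summable]) auto
    finally show ?thesis .
  qed
  then show ?thesis
    by blast
qed

end
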